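(* Let $m\ge 1$ and let $M$ be a color complete $m$-pole. Then the number $\sigma(m)$ of states of $M$ (counted up to permutation of the three colors) is $$\sigma(m)=\frac{1}{8}\left[3^{m-1}+2+(-1)^m\,3\right].$$
   Context: An $m$-pole ($m\ge 1$), or multipole, $M=(V,E,\mathcal{E})$ consists of a finite set $V$ of vertices, a finite collection $E$ of edges (unordered pairs of vertices; parallel edges and loops may occur), and a set $\mathcal{E}=\{\epsilon_1,\dots,\epsilon_m\}$ of $m$ semiedges. Each semiedge is either incident to exactly one vertex, or is paired with another semiedge to form a free (isolated) edge, which has no vertices. All multipoles are cubic: for each vertex, the number of edges (loops counted twice) plus semiedges incident to it is $3$. A multipole may be disconnected, and $V$ may be empty. A Tait coloring of $M$ is a map $\phi:E\cup\mathcal{E}\to\{1,2,3\}$ such that the three edges/semiedges incident with any vertex receive distinct colors (so a multipole with a loop has none) and the two semiedges of any free edge receive the same color. A state of $M$ is a tuple $(\phi(\epsilon_1),\dots,\phi(\epsilon_m))$ with $\phi$ a Tait coloring of $M$. Two states are equivalent if one is obtained from the other by a permutation of the colors; the number of states of $M$ means the number of equivalence classes of states. A tuple in $\{1,2,3\}^m$ is admissible if, with $m_i$ the number of entries equal to $i$, $m_1\equiv m_2\equiv m_3\equiv m\pmod 2$. (By the Parity Lemma every state is admissible.) $M$ is color complete if every admissible tuple is a state of $M$. *)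

theory Defs
  imports Main "HOL-Library.Multiset" "HOL-Number_Theory.Cong" "HOL-Combinatorics.Permutations"
    Complex_Main
begin

datatype 'v semi_end = At_Vertex 'v | Paired_With nat

text \<open>
  The semiedges of an \<open>m\<close>-pole are the indices \<open>1, \<dots>, m\<close>. Edges have names, so parallel
  edges are possible; the ends of an edge form a multiset of size two, a loop at \<open>v\<close> having
  ends \<open>{#v, v#}\<close>. Two semiedges pointing at each other form a free edge.
\<close>
record ('v, 'e) pre_multipole =
  num_semi :: nat
  verts :: "'v set"
  edges :: "'e set"
  ends :: "'e \<Rightarrow> 'v multiset"
  attach :: "nat \<Rightarrow> 'v semi_end"

abbreviation semiedges :: "('v, 'e) pre_multipole \<Rightarrow> nat set" where
  "semiedges M \<equiv> {1..num_semi M}"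

datatype 'e link = Edge 'e | Semiedge nat

definition links :: "('v, 'e) pre_multipole \<Rightarrow> 'e link set" where
  "links M = Edge ` edges M \<union> Semiedge ` semiedges M"

text \<open>The edges and semiedges at a vertex, a loop being listed twice.\<close>
definition incident :: "('v, 'e) pre_multipole \<Rightarrow> 'v \<Rightarrow> 'e link multiset" where
  "incident M v =
     (\<Sum>e\<in>edges M. replicate_mset (count (ends M e) v) (Edge e)) +
     image_mset Semiedge (mset_set {i \<in> semiedges M. attach M i = At_Vertex v})"

definition multipole :: "nat \<Rightarrow> ('v, 'e) pre_multipole \<Rightarrow> bool" where
  "multipole m M \<longleftrightarrow>
     num_semi M = m \<and> finite (verts M) \<and> finite (edges M) \<and>
     (\<forall>e\<in>edges M. size (ends M e) = 2 \<and> set_mset (ends M e) \<subseteq> verts M) \<and>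
     (\<forall>i\<in>semiedges M. case attach M i of
        At_Vertex v \<Rightarrow> v \<in> verts M
      | Paired_With j \<Rightarrow> j \<in> semiedges M \<and> j \<noteq> i \<and> attach M j = Paired_With i) \<and>
     (\<forall>v\<in>verts M. size (incident M v) = 3)"

abbreviation colors :: "nat set" where
  "colors \<equiv> {1, 2, 3}"

text \<open>
  Distinctness of the colors at a vertex is imposed on the multiset of incidences, so that
  it fails at a loop, whose color occurs twice.
\<close>
definition tait_coloring :: "('v, 'e) pre_multipole \<Rightarrow> ('e link \<Rightarrow> nat) \<Rightarrow> bool" where
  "tait_coloring M \<phi> \<longleftrightarrow>
     (\<forall>x\<in>links M. \<phi> x \<in> colors) \<and>
     (\<forall>v\<in>verts M. \<forall>c. count (image_mset \<phi> (incident M v)) c \<le> 1) \<and>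
     (\<forall>i\<in>semiedges M. \<forall>j. attach M i = Paired_With j \<longrightarrow> \<phi> (Semiedge i) = \<phi> (Semiedge j))"

definition states :: "('v, 'e) pre_multipole \<Rightarrow> nat list set" where
  "states M = {map (\<lambda>i. \<phi> (Semiedge i)) [1..<Suc (num_semi M)] | \<phi>. tait_coloring M \<phi>}"

definition state_equiv :: "('v, 'e) pre_multipole \<Rightarrow> (nat list \<times> nat list) set" where
  "state_equiv M =
     {(s, t). s \<in> states M \<and> t \<in> states M \<and> (\<exists>\<pi>. \<pi> permutes colors \<and> t = map \<pi> s)}"

definition num_states :: "('v, 'e) pre_multipole \<Rightarrow> nat" where
  "num_states M = card (states M // state_equiv M)"

definition admissible :: "nat \<Rightarrow> nat list \<Rightarrow> bool" where
  "admissible m t \<longleftrightarrow>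
     length t = m \<and> set t \<subseteq> colors \<and> (\<forall>c\<in>colors. [count_list t c = m] (mod 2))"

definition color_complete :: "('v, 'e) pre_multipole \<Rightarrow> bool" where
  "color_complete M \<longleftrightarrow> (\<forall>t. admissible (num_semi M) t \<longrightarrow> t \<in> states M)"

end

theory Submission imports Defs begin

text \<open>
  Reading the colors as the nonzero elements of the Klein four-group, a tuple is admissible iff its
  entries sum to zero. Every tuple of length \<open>m\<close> that is not admissible therefore extends by
  exactly one color to an admissible one, which gives \<open>a (m + 1) = 3 ^ m - a m\<close> for the number
  \<open>a m\<close> of admissible tuples. The states of a color complete multipole are exactly the
  admissible tuples. The symmetric group on the colors acts freely on the nonconstant ones, while
  the constant ones, admissible iff \<open>m\<close> is even, form one orbit of size three.
\<close>

section \<open>The Parity Lemma\<close>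

text \<open>The order selects one element from each two-cycle, and \<open>f\<close> matches the
  selected elements with the others. Applied below to the semiedges that form free edges.\<close>

lemma even_card_fixpoint_free_involution:
  fixes f :: "'a::linorder \<Rightarrow> 'a"
  assumes "finite P" and f: "\<And>i. i \<in> P \<Longrightarrow> f i \<in> P \<and> f i \<noteq> i \<and> f (f i) = i"
  shows "even (card P)"
proof -
  let ?A = "{i \<in> P. i < f i}" and ?B = "{i \<in> P. f i < i}"
  have "bij_betw f ?A ?B"
    by (rule bij_betw_byWitness[where f' = f]) (use f in auto)
  then have "card ?A = card ?B"
    by (rule bij_betw_same_card)
  moreover have "P = ?A \<union> ?B"
    using f by (auto simp: neq_iff)
  moreover have "card (?A \<union> ?B) = card ?A + card ?B"
    using \<open>finite P\<close> by (intro card_Un_disjoint) auto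
  ultimately show ?thesis
    by simp
qed

lemma count_incident:
  assumes "finite (edges M)"
  shows "count (image_mset \<phi> (incident M v)) c =
    (\<Sum>e\<in>edges M. if \<phi> (Edge e) = c then count (ends M e) v else 0) +
    card {i \<in> semiedges M. attach M i = At_Vertex v \<and> \<phi> (Semiedge i) = c}"
proof -
  have "count (image_mset \<phi> (\<Sum>e\<in>E. replicate_mset (count (ends M e) v) (Edge e))) c =
      (\<Sum>e\<in>E. if \<phi> (Edge e) = c then count (ends M e) v else 0)" if "finite E" for E
    using that by induction auto
  moreover have "count (image_mset \<phi> (image_mset Semiedge (mset_set S))) c =
      card {i \<in> S. \<phi> (Semiedge i) = c}" if "finite S" for S
  proof -
    have "count (image_mset \<phi> (image_mset Semiedge (mset_set S))) c =
        (\<Sum>i\<in>S. if \<phi> (Semiedge i) = c then 1 else 0)"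
      using that by induction auto
    also have "\<dots> = card {i \<in> S. \<phi> (Semiedge i) = c}"
      using that by (simp add: sum.If_cases Int_def)
    finally show ?thesis .
  qed
  ultimately show ?thesis
    using assms by (simp add: incident_def conj_assoc)
qed

lemma sum_count_eq_size:
  assumes "finite V" and "set_mset A \<subseteq> V"
  shows "(\<Sum>v\<in>V. count A v) = size A"
  unfolding size_multiset_overloaded_eq
  by (rule sum.mono_neutral_right) (use assms in \<open>auto simp: not_in_iff\<close>)

lemma incident_subset_links:
  assumes "finite (edges M)"
  shows "set_mset (incident M v) \<subseteq> links M"
  using assms by (auto simp: incident_def links_def set_mset_sum split: if_splits)

text \<open>Three incidences share three colors, each used at most once, so each is used exactly
  once.\<close>

lemma count_color_at_vertex:
  assumes "multipole m M" and "tait_coloring M \<phi>" and "v \<in> verts M" and "c \<in> colors"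
  shows "count (image_mset \<phi> (incident M v)) c = 1"
proof -
  let ?A = "image_mset \<phi> (incident M v)"
  have "set_mset ?A \<subseteq> colors"
    using incident_subset_links[of M v] assms(1,2)
    by (fastforce simp: multipole_def tait_coloring_def)
  then have "(\<Sum>c\<in>colors. count ?A c) = size ?A"
    by (intro sum_count_eq_size) auto
  also have "\<dots> = 3"
    using assms(1,3) by (simp add: multipole_def)
  finally have "count ?A 1 + (count ?A 2 + count ?A 3) = 3"
    by simp
  moreover have "\<forall>c. count ?A c \<le> 1"
    using assms(2,3) by (simp add: tait_coloring_def)
  then have "count ?A 1 \<le> 1" "count ?A 2 \<le> 1" "count ?A 3 \<le> 1"
    by blast+
  ultimately show ?thesis
    using assms(4) by auto
qed

text \<open>Double counting: every vertex sees color \<open>c\<close> exactly once, so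
  \<open>card (verts M)\<close> counts the incidences of color \<open>c\<close>. An edge of that
  color contributes two, a semiedge at a vertex one; the remaining semiedges of that color pair up
  into free edges.\<close>

lemma even_semiedges_plus_verts:
  assumes M: "multipole m M" and \<phi>: "tait_coloring M \<phi>" and c: "c \<in> colors"
  shows "even (card {i \<in> semiedges M. \<phi> (Semiedge i) = c} + card (verts M))"
proof -
  let ?S = "{i \<in> semiedges M. \<phi> (Semiedge i) = c}"
  let ?At = "\<lambda>v. {i \<in> semiedges M. attach M i = At_Vertex v \<and> \<phi> (Semiedge i) = c}"
  let ?P = "{i \<in> ?S. \<exists>j. attach M i = Paired_With j}"
  have fin: "finite (verts M)" "finite (edges M)"
    and semi: "\<And>i. i \<in> semiedges M \<Longrightarrow> (case attach M i of At_Vertex v \<Rightarrow> v \<in> verts M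
      | Paired_With j \<Rightarrow> j \<in> semiedges M \<and> j \<noteq> i \<and> attach M j = Paired_With i)"
    using M by (auto simp: multipole_def)
  have "card (verts M) = (\<Sum>v\<in>verts M. count (image_mset \<phi> (incident M v)) c)"
    using count_color_at_vertex[OF M \<phi> _ c] by simp
  also have "\<dots> = (\<Sum>e\<in>edges M. \<Sum>v\<in>verts M. if \<phi> (Edge e) = c then count (ends M e) v else 0) +
      (\<Sum>v\<in>verts M. card (?At v))"
    unfolding count_incident[OF fin(2)] sum.distrib by (subst sum.swap) simp
  \<comment> \<open>A loop also contributes two, since \<open>ends\<close> lists its vertex
    twice.\<close>
  also have "(\<Sum>e\<in>edges M. \<Sum>v\<in>verts M. if \<phi> (Edge e) = c then count (ends M e) v else 0) =
      (\<Sum>e\<in>edges M. if \<phi> (Edge e) = c then 2 else 0)"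
    using M by (intro sum.cong) (auto simp: multipole_def sum_count_eq_size)
  also have "(\<Sum>v\<in>verts M. card (?At v)) = card (\<Union>v\<in>verts M. ?At v)"
    using fin by (intro card_UN_disjoint[symmetric]) auto
  finally have verts: "card (verts M) =
      (\<Sum>e\<in>edges M. if \<phi> (Edge e) = c then 2 else 0) + card (\<Union>v\<in>verts M. ?At v)" .
  have "?S = (\<Union>v\<in>verts M. ?At v) \<union> ?P"
  proof (intro subset_antisym subsetI)
    fix i
    assume "i \<in> ?S"
    then show "i \<in> (\<Union>v\<in>verts M. ?At v) \<union> ?P"
      using semi[of i] by (cases "attach M i") auto
  qed auto
  moreover have "card ((\<Union>v\<in>verts M. ?At v) \<union> ?P) = card (\<Union>v\<in>verts M. ?At v) + card ?P"
    using fin by (intro card_Un_disjoint) auto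
  ultimately have "card ?S = card (\<Union>v\<in>verts M. ?At v) + card ?P"
    by (simp only:)
  moreover have "even (card ?P)"
  proof (rule even_card_fixpoint_free_involution)
    \<comment> \<open>The partner map; its unspecified value at semiedges attached to a vertex is
      harmless, as \<open>?P\<close> contains none of them.\<close>
    let ?f = "\<lambda>i. case attach M i of Paired_With j \<Rightarrow> j"
    show "?f i \<in> ?P \<and> ?f i \<noteq> i \<and> ?f (?f i) = i" if "i \<in> ?P" for i
    proof -
      from that obtain j where j: "attach M i = Paired_With j"
        by blast
      have "\<phi> (Semiedge i) = \<phi> (Semiedge j)"
        using that j \<phi> unfolding tait_coloring_def by blast
      then show ?thesis
        using that j semi[of i] by auto
    qed
  qed simp
  moreover have "even (\<Sum>e\<in>edges M. if \<phi> (Edge e) = c then 2 else 0 :: nat)"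
    by (intro dvd_sum) simp
  ultimately show ?thesis
    unfolding verts by presburger
qed

lemma sum_count_list_colors:
  assumes "set t \<subseteq> colors"
  shows "count_list t 1 + count_list t 2 + count_list t 3 = length t"
  using assms by (induction t) auto

lemma states_admissible:
  assumes M: "multipole m M" and "s \<in> states M"
  shows "admissible m s"
proof -
  have m: "num_semi M = m"
    using M by (simp add: multipole_def)
  obtain \<phi> where \<phi>: "tait_coloring M \<phi>" and s: "s = map (\<lambda>i. \<phi> (Semiedge i)) [1..<Suc m]"
    using \<open>s \<in> states M\<close> m by (auto simp: states_def)
  have colors: "set s \<subseteq> colors"
    using \<phi> m by (auto simp: s tait_coloring_def links_def)
  have "count_list s c = card {i \<in> semiedges M. \<phi> (Semiedge i) = c}" for c
  proof -
    have "count_list s c = length (filter (\<lambda>i. \<phi> (Semiedge i) = c) [1..<Suc m])"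
      unfolding s count_list_eq_length_filter filter_map length_map o_def
      by (rule arg_cong[of _ _ length], rule filter_cong) auto
    also have "\<dots> = card (set (filter (\<lambda>i. \<phi> (Semiedge i) = c) [1..<Suc m]))"
      by (rule distinct_card[symmetric]) simp
    also have "set (filter (\<lambda>i. \<phi> (Semiedge i) = c) [1..<Suc m]) =
        {i \<in> semiedges M. \<phi> (Semiedge i) = c}"
      unfolding m by auto
    finally show ?thesis .
  qed
  then have par: "even (count_list s c + card (verts M))" if "c \<in> colors" for c
    using even_semiedges_plus_verts[OF M \<phi> that] by simp
  have len: "length s = m"
    by (simp add: s)
  \<comment> \<open>\<open>m\<close> is the sum of three counts that all have the parity of
    \<open>card (verts M)\<close>, so it has that parity too.\<close>
  have "even (m + card (verts M))"
    using par[of 1] par[of 2] par[of 3] sum_count_list_colors[OF colors] len by simp presburger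
  then have "[count_list s c = m] (mod 2)" if "c \<in> colors" for c
    using par[OF that] by (simp add: cong_def) presburger
  then show ?thesis
    using colors len by (simp add: admissible_def)
qed

section \<open>Counting admissible tuples\<close>

lemma admissible_iff_even:
  "admissible m t \<longleftrightarrow> length t = m \<and> set t \<subseteq> colors \<and> even (count_list t 1 + m) \<and>
    even (count_list t 2 + m) \<and> even (count_list t 3 + m)"
proof -
  have "[a = b] (mod 2) \<longleftrightarrow> even (a + b)" for a b :: nat
    unfolding cong_def by presburger
  then show ?thesis
    by (simp add: admissible_def)
qed

lemma finite_admissible: "finite {t. admissible m t}"
  by (rule finite_subset[OF _ finite_lists_length_eq[of colors m]]) (auto simp: admissible_def)

lemma card_admissible_Suc:
  "card {t. admissible (Suc m) t} + card {t. admissible m t} = 3 ^ m"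
proof -
  let ?L = "{t. set t \<subseteq> colors \<and> length t = m}"
  have "bij_betw tl {t. admissible (Suc m) t} (?L - {t. admissible m t})"
  proof (rule bij_betw_imageI)
    show "inj_on tl {t. admissible (Suc m) t}"
    \<comment> \<open>The tail determines the head: it is the only color whose count in the tail
      differs in parity from \<open>Suc m\<close>.\<close>
    proof (rule inj_onI)
      fix s t
      assume "s \<in> {t. admissible (Suc m) t}" "t \<in> {t. admissible (Suc m) t}" "tl s = tl t"
      then show "s = t"
        by (cases s; cases t) (auto simp: admissible_iff_even)
    qed
    show "tl ` {t. admissible (Suc m) t} = ?L - {t. admissible m t}"
    proof (intro subset_antisym subsetI)
      fix t
      assume "t \<in> tl ` {t. admissible (Suc m) t}"
      then obtain s where "admissible (Suc m) s" "t = tl s"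
        by blast
      then show "t \<in> ?L - {t. admissible m t}"
        by (cases s) (auto simp: admissible_iff_even)
    next
      fix t
      assume t: "t \<in> ?L - {t. admissible m t}"
      then have col: "set t \<subseteq> colors" and len: "length t = m" and "\<not> admissible m t"
        by auto
      then have "\<not> (even (count_list t 1 + m) \<and> even (count_list t 2 + m) \<and>
          even (count_list t 3 + m))"
        unfolding admissible_iff_even by blast
      moreover have "count_list t 1 + count_list t 2 + count_list t 3 = m"
        using sum_count_list_colors[OF col] len by simp
      \<comment> \<open>The numbers \<open>i + m\<close>, \<open>j + m\<close>, \<open>k + m\<close>
        add up to \<open>4 * m\<close>, so an even number of them is odd: if not none, then exactly
        two. Passing to \<open>Suc m\<close> leaves a single wrong parity, and prepending that color
        repairs it.\<close>
      moreover have "(odd (i + Suc m) \<and> even (j + Suc m) \<and> even (k + Suc m)) \<or>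
          (even (i + Suc m) \<and> odd (j + Suc m) \<and> even (k + Suc m)) \<or>
          (even (i + Suc m) \<and> even (j + Suc m) \<and> odd (k + Suc m))"
        if "\<not> (even (i + m) \<and> even (j + m) \<and> even (k + m))" "i + j + k = m" for i j k
        using that by presburger
      ultimately consider
          "odd (count_list t 1 + Suc m)" "even (count_list t 2 + Suc m)" "even (count_list t 3 + Suc m)"
        | "even (count_list t 1 + Suc m)" "odd (count_list t 2 + Suc m)" "even (count_list t 3 + Suc m)"
        | "even (count_list t 1 + Suc m)" "even (count_list t 2 + Suc m)" "odd (count_list t 3 + Suc m)"
        by blast
      then have "\<exists>c\<in>colors. admissible (Suc m) (c # t)"
        using col len by cases (auto simp: admissible_iff_even)
      then show "t \<in> tl ` {t. admissible (Suc m) t}"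
        by (force simp: image_iff)
    qed
  qed
  then have "card {t. admissible (Suc m) t} = card (?L - {t. admissible m t})"
    by (rule bij_betw_same_card)
  also have "\<dots> = card ?L - card {t. admissible m t}"
    by (intro card_Diff_subset finite_admissible) (auto simp: admissible_def)
  also have "card ?L = 3 ^ m"
    by (simp add: card_lists_length_eq numeral_3_eq_3)
  finally have "card {t. admissible (Suc m) t} = 3 ^ m - card {t. admissible m t}" .
  moreover have "card {t. admissible m t} \<le> card ?L"
    by (rule card_mono[OF finite_lists_length_eq]) (auto simp: admissible_def)
  ultimately show ?thesis
    using \<open>card ?L = 3 ^ m\<close> by simp
qed

text \<open>This solves the recurrence just proved; the factor 4 avoids division. The induction
  starts from the empty tuple, which is admissible.\<close>

lemma card_admissible:
  "4 * int (card {t. admissible m t}) = 3 ^ m + 3 * (-1) ^ m"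
proof (induction m)
  case 0
  have "{t. admissible 0 t} = {[]}"
    by (auto simp: admissible_def)
  then show ?case
    by simp
next
  case (Suc m)
  have "int (card {t. admissible (Suc m) t}) + int (card {t. admissible m t}) = 3 ^ m"
    using card_admissible_Suc[of m] by (metis of_nat_add of_nat_numeral of_nat_power)
  then show ?case
    using Suc by simp
qed

section \<open>Orbits of the color permutations\<close>

text \<open>No multipole is mentioned, so the counting takes place among tuples alone; for a color
  complete multipole the orbits of states are the classes of \<open>state_equiv\<close>.\<close>

definition orbit :: "nat list \<Rightarrow> nat list set" where
  "orbit s = (\<lambda>\<pi>. map \<pi> s) ` {\<pi>. \<pi> permutes colors}"

text \<open>Recoloring only permutes the three counts, and admissibility treats the colors
  alike.\<close>

lemma admissible_map_permutes:
  assumes \<pi>: "\<pi> permutes colors" and s: "admissible m s"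
  shows "admissible m (map \<pi> s)"
proof -
  have cl: "count_list (map \<pi> s) c = count_list s (inv \<pi> c)" for c
  proof -
    have "(c = \<pi> x) = (inv \<pi> c = x)" for x
      using \<pi> by (metis permutes_inverses)
    then show ?thesis
      by (simp add: count_list_eq_length_filter filter_map o_def)
  qed
  have "inv \<pi> c \<in> colors" if "c \<in> colors" for c
    using that permutes_in_image[OF permutes_inv[OF \<pi>]] by blast
  moreover have "set (map \<pi> s) \<subseteq> colors"
    using s permutes_image[OF \<pi>] by (fastforce simp: admissible_def)
  ultimately show ?thesis
    using s unfolding admissible_def cl length_map by blast
qed

lemma mem_orbit_self: "s \<in> orbit s"
  unfolding orbit_def by (rule image_eqI[where x = id]) (auto simp: permutes_id)

lemma orbit_eq:
  assumes "t \<in> orbit s"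
  shows "orbit t = orbit s"
proof -
  obtain \<pi> where \<pi>: "\<pi> permutes colors" and t: "t = map \<pi> s"
    using assms by (auto simp: orbit_def)
  have s: "s = map (inv \<pi>) t"
    using permutes_inv_o(2)[OF \<pi>] by (simp add: t)
  have "orbit (map \<sigma> u) \<subseteq> orbit u" if "\<sigma> permutes colors" for \<sigma> u
    using that by (auto simp: orbit_def intro!: permutes_compose)
  then show ?thesis
    using \<pi> permutes_inv[OF \<pi>] s t by (metis subset_antisym)
qed

text \<open>A permutation of three colors is determined by its values at \<open>a\<close> and
  \<open>b\<close>, so all \<open>3!\<close> permutations give different tuples.\<close>

lemma card_orbit_nonconstant:
  assumes "set s \<subseteq> colors" and "a \<in> set s" and "b \<in> set s" and "a \<noteq> b"
  shows "card (orbit s) = 6"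
proof -
  have "inj_on (\<lambda>\<pi>. map \<pi> s) {\<pi>. \<pi> permutes colors}"
  proof (rule inj_onI)
    fix \<pi> \<sigma>
    assume "\<pi> \<in> {\<pi>. \<pi> permutes colors}" "\<sigma> \<in> {\<pi>. \<pi> permutes colors}" "map \<pi> s = map \<sigma> s"
    then have \<pi>: "\<pi> permutes colors" and \<sigma>: "\<sigma> permutes colors"
      and ab: "\<pi> a = \<sigma> a" "\<pi> b = \<sigma> b"
      using assms by auto
    \<comment> \<open>The third color must go to the only color left over.\<close>
    have "\<pi> x = \<sigma> x" if x: "x \<in> colors" "x \<noteq> a" "x \<noteq> b" for x
    proof -
      have "\<tau> x \<in> colors - {\<tau> a, \<tau> b}" if "\<tau> permutes colors" for \<tau>
        using permutes_in_image[OF that, of x] permutes_inj[OF that] x by (auto dest: injD)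
      from this[OF \<pi>] this[OF \<sigma>]
      have "\<pi> x \<in> colors - {\<sigma> a, \<sigma> b}" "\<sigma> x \<in> colors - {\<sigma> a, \<sigma> b}"
        by (simp_all only: ab)
      moreover have "card (colors - {\<sigma> a, \<sigma> b}) = 1"
      proof -
        have "\<sigma> a \<noteq> \<sigma> b"
          using permutes_inj[OF \<sigma>] assms(4) by (auto dest: injD)
        moreover have "{\<sigma> a, \<sigma> b} \<subseteq> colors"
          using permutes_in_image[OF \<sigma>] assms by blast
        ultimately show ?thesis
          by (subst card_Diff_subset) auto
      qed
      ultimately show ?thesis
        by (metis card_1_singletonE singletonD)
    qed
    moreover have "\<pi> x = \<sigma> x" if "x \<notin> colors" for x
      using \<pi> \<sigma> that by (metis permutes_not_in)
    ultimately show "\<pi> = \<sigma>"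
      using ab by (metis ext)
  qed
  then have "card (orbit s) = card {\<pi>. \<pi> permutes colors}"
    unfolding orbit_def by (rule card_image)
  also have "\<dots> = fact 3"
    by (rule card_permutations) auto
  finally show ?thesis
    by (simp add: fact_numeral)
qed

lemma orbit_replicate:
  assumes "c \<in> colors"
  shows "orbit (replicate m c) = replicate m ` colors"
proof -
  have "(\<lambda>\<pi>. \<pi> c) ` {\<pi>. \<pi> permutes colors} = colors"
  proof (intro subset_antisym subsetI)
    fix d
    assume "d \<in> colors"
    then have "transpose c d permutes colors"
      using assms by (intro permutes_swap_id)
    then show "d \<in> (\<lambda>\<pi>. \<pi> c) ` {\<pi>. \<pi> permutes colors}"
      by (intro image_eqI[where x = "transpose c d"]) auto
  next
    fix d
    assume "d \<in> (\<lambda>\<pi>. \<pi> c) ` {\<pi>. \<pi> permutes colors}"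
    then obtain \<pi> where "\<pi> permutes colors" "d = \<pi> c"
      by blast
    then show "d \<in> colors"
      using assms permutes_in_image by metis
  qed
  then have "replicate m ` (\<lambda>\<pi>. \<pi> c) ` {\<pi>. \<pi> permutes colors} = replicate m ` colors"
    by (rule arg_cong)
  then show ?thesis
    by (simp add: orbit_def image_image)
qed

text \<open>The two colors other than \<open>c\<close> occur zero times, which forces
  \<open>m\<close> to be even.\<close>

lemma admissible_replicate:
  assumes "m \<ge> 1" and "c \<in> colors"
  shows "admissible m (replicate m c) \<longleftrightarrow> even m"
proof -
  have "count_list (replicate k c) d = (if d = c then k else 0)" for k d
    by (induction k) auto
  then show ?thesis
    using assms by (auto simp: admissible_iff_even)
qed

text \<open>Every orbit has six elements except that of the constant tuples, present only for even
  \<open>m\<close>; the added 3 pads it to six.\<close>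

lemma card_orbits:
  assumes "m \<ge> 1"
  shows "card {t. admissible m t} + (if even m then 3 else 0) = 6 * card (orbit ` {t. admissible m t})"
proof -
  let ?A = "{t. admissible m t}" and ?K = "replicate m ` colors"
  let ?Q = "orbit ` ?A"
  have six: "card (orbit s) = 6" if s: "s \<in> ?A" and "orbit s \<noteq> ?K" for s
  proof (cases "\<exists>a\<in>set s. \<exists>b\<in>set s. a \<noteq> b")
    case True
    then show ?thesis
      using s card_orbit_nonconstant by (auto simp: admissible_def)
  next
    case False
    have "s \<noteq> []" "length s = m" "set s \<subseteq> colors"
      using s assms by (auto simp: admissible_def)
    moreover from this have "s = replicate m (hd s)"
      using False by (metis hd_in_set replicate_eqI)
    ultimately show ?thesis
      using that(2) orbit_replicate by (metis hd_in_set subsetD)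
  qed
  have K: "?K \<in> ?Q \<longleftrightarrow> even m"
  proof
    assume "?K \<in> ?Q"
    then obtain s where s: "admissible m s" "?K = orbit s"
      by auto
    then have "s \<in> ?K"
      using mem_orbit_self by simp
    then show "even m"
      using s assms admissible_replicate by auto
  next
    assume "even m"
    then show "?K \<in> ?Q"
      using assms admissible_replicate[of m 1] orbit_replicate[of 1 m] by (auto intro!: image_eqI)
  qed
  \<comment> \<open>Here \<open>m \<ge> 1\<close> keeps the three constant tuples distinct.\<close>
  have "card ?K = 3"
    using assms by (subst card_image) (auto simp: inj_on_def)
  have fin: "finite ?Q"
    by (intro finite_imageI finite_admissible)
  have "orbit s \<subseteq> ?A" if "s \<in> ?A" for s
    using that admissible_map_permutes by (auto simp: orbit_def)
  then have "?A = \<Union>?Q"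
    using mem_orbit_self by blast
  also have "card \<dots> = (\<Sum>q\<in>?Q. card q)"
  proof (rule card_Union_disjoint)
    show "pairwise disjnt ?Q"
      unfolding pairwise_def disjnt_iff using orbit_eq by blast
    show "finite q" if "q \<in> ?Q" for q
      using that by (auto simp: orbit_def finite_permutations)
  qed
  also have "\<dots> = (\<Sum>q\<in>?Q. if q = ?K then 3 else 6)"
    by (rule sum.cong) (use six \<open>card ?K = 3\<close> in auto)
  finally have card: "card ?A = (\<Sum>q\<in>?Q. if q = ?K then 3 else 6)" .
  \<comment> \<open>By \<open>K\<close>, the second sum has its one nonzero term exactly when
    \<open>m\<close> is even.\<close>
  have "card ?A + (if even m then 3 else 0) =
      (\<Sum>q\<in>?Q. if q = ?K then 3 else 6) + (\<Sum>q\<in>?Q. if q = ?K then 3 else 0)"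
    using K fin by (simp add: card)
  also have "\<dots> = (\<Sum>q\<in>?Q. 6)"
    unfolding sum.distrib[symmetric] by (rule sum.cong) auto
  finally show ?thesis
    by simp
qed

theorem lemma3p1:
  fixes m :: nat and M :: "('v, 'e) pre_multipole"
  assumes "m \<ge> 1" and "multipole m M" and "color_complete M"
  shows "real (num_states M) = 1 / 8 * (3 ^ (m - 1) + 2 + (-1) ^ m * 3)"
proof -
  \<comment> \<open>One inclusion is the Parity Lemma, the other is color completeness.\<close>
  have st: "states M = {t. admissible m t}"
    using assms states_admissible by (auto simp: color_complete_def multipole_def)
  \<comment> \<open>A recolored state is admissible, hence again a state, so no part of the orbit is
    lost.\<close>
  have "state_equiv M `` {s} = orbit s" if "admissible m s" for s
    using that admissible_map_permutes by (auto simp: state_equiv_def orbit_def st)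
  then have "states M // state_equiv M = orbit ` {t. admissible m t}"
    unfolding quotient_def st by auto
  then have "card {t. admissible m t} + (if even m then 3 else 0) = 6 * num_states M"
    using card_orbits[OF assms(1)] by (simp add: num_states_def)
  \<comment> \<open>Scaling by 4 matches the form of \<open>card_admissible\<close>.\<close>
  then have "24 * int (num_states M) =
      4 * int (card {t. admissible m t}) + (if even m then 12 else 0)"
    by (auto split: if_splits)
  then have "24 * int (num_states M) = 3 ^ m + 3 * (-1) ^ m + (if even m then 12 else 0)"
    by (simp only: card_admissible)
  then have "real_of_int (24 * int (num_states M)) =
      real_of_int (3 ^ m + 3 * (-1) ^ m + (if even m then 12 else 0))"
    by (rule arg_cong)
  moreover have "(3::real) ^ m = 3 * 3 ^ (m - 1)"
    using assms(1) by (metis Suc_diff_1 less_eq_Suc_le One_nat_def power_Suc)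
  \<comment> \<open>After division by 3, the terms \<open>(-1) ^ m\<close> and 4 (for even
    \<open>m\<close> only) combine to \<open>2 + 3 * (-1) ^ m\<close>: 5 for even \<open>m\<close>,
    -1 for odd \<open>m\<close>.\<close>
  ultimately show ?thesis
    by (cases "even m") auto
qed

end
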